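(* (1) $\mathbf{K_F}$ is sound with respect to the class of all EGL-models. (2) $\mathbf{B_F}$ is sound with respect to the class of all serial and transitive EGL-models. (3) $\mathbf{T_F}$ is sound with respect to the class of all serial, transitive and reflexive EGL-models. Here a system $\mathbf A$ is sound with respect to a class $\mathcal M$ of models if, for every formula $\varphi$, $\vdash_{\mathbf A}\varphi$ implies that $\varphi$ is true in every $M\in\mathcal M$.
   Context: Fix a set $\mathcal P$ of atomic propositions and a set $\mathcal A$ of agents. Formulas: $\varphi ::= p \mid \bot \mid \varphi\wedge\varphi \mid \varphi\to\varphi \mid B_a\varphi$ with $p\in\mathcal P$, $a\in\mathcal A$; $\neg\varphi=\varphi\to\bot$. An EGL-model (model) is $M=(S,(r_a)_{a\in\mathcal A},\pi)$ where $S$ is a non-empty countable set, each $r_a:S\times S\to[0,1]$, and $\pi:S\times\mathcal P\to[0,1]$. Values: $V_s(p)=\pi(s,p)$; $V_s(\bot)=0$; $V_s(\varphi\wedge\psi)=\min\{V_s(\varphi),V_s(\psi)\}$; $V_s(\varphi\to\psi)=1$ if $V_s(\varphi)\le V_s(\psi)$ and $=V_s(\psi)$ otherwise; $V_s(B_a\varphi)=\inf_{s'\in S}\max\{1-r_a(s,s'),V_{s'}(\varphi)\}$. $\varphi$ is true in $M$ if $V_s(\varphi)=1$ for all $s\in S$; $\varphi$ is valid if true in all models. $M$ is serial if for all $a,s$ there is $s'$ with $r_a(s,s')=1$; reflexive if $r_a(s,s)=1$ for all $a,s$; transitive if $r_a(s,s'')\ge\min\{r_a(s,s'),r_a(s',s'')\}$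 for all $a,s,s',s''$. Axioms and rules: (A) all instances of tautologies of propositional Gödel logic; (K) $B_a(\varphi\to\psi)\to(B_a\varphi\to B_a\psi)$; (D) $\neg B_a\bot$; (4) $B_a\varphi\to B_aB_a\varphi$; (T) $B_a\varphi\to\varphi$; (R1) modus ponens; (R2) from $\varphi$ infer $B_a\varphi$. $\mathbf{K_F}$ = (A),(K),(R1),(R2); $\mathbf{B_F}$ = $\mathbf{K_F}$ + (D),(4); $\mathbf{T_F}$ = $\mathbf{B_F}$ + (T). $\vdash_{\mathbf A}\varphi$ means there is a finite sequence of formulas ending in $\varphi$ each of which is an axiom of $\mathbf A$ or is obtained from earlier ones by (R1) or (R2), with the restriction that (R2) cannot be applied to non-valid formulas. *)

theory Defs
  imports Complex_Main "HOL-Library.Countable_Set"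
begin

datatype ('a, 'p) fm =
    Atom 'p
  | Bot
  | And "('a, 'p) fm" "('a, 'p) fm"
  | Imp "('a, 'p) fm" "('a, 'p) fm"
  | B 'a "('a, 'p) fm"

abbreviation Neg :: "('a, 'p) fm \<Rightarrow> ('a, 'p) fm" where
  "Neg \<phi> \<equiv> Imp \<phi> Bot"

definition goedel_imp :: "real \<Rightarrow> real \<Rightarrow> real" where
  "goedel_imp x y = (if x \<le> y then 1 else y)"


record ('s, 'a, 'p) egl =
  states :: "'s set"
  rel :: "'a \<Rightarrow> 's \<Rightarrow> 's \<Rightarrow> real"
  interp :: "'s \<Rightarrow> 'p \<Rightarrow> real"

(* The functions in the record are total on the type 's; only their restrictions to the
   carrier belong to the model, so every condition below is relativised to it. *)
definition egl_model :: "('s, 'a, 'p) egl \<Rightarrow> bool" where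
  "egl_model M \<longleftrightarrow>
     states M \<noteq> {} \<and> countable (states M) \<and>
     (\<forall>a. \<forall>s\<in>states M. \<forall>s'\<in>states M. rel M a s s' \<in> {0..1}) \<and>
     (\<forall>s\<in>states M. \<forall>p. interp M s p \<in> {0..1})"

primrec val :: "('s, 'a, 'p) egl \<Rightarrow> ('a, 'p) fm \<Rightarrow> 's \<Rightarrow> real" where
  "val M (Atom p) s = interp M s p"
| "val M Bot s = 0"
| "val M (And \<phi> \<psi>) s = min (val M \<phi> s) (val M \<psi> s)"
| "val M (Imp \<phi> \<psi>) s = goedel_imp (val M \<phi> s) (val M \<psi> s)"
| "val M (B a \<phi>) s = (INF s'\<in>states M. max (1 - rel M a s s') (val M \<phi> s'))"

definition true_in :: "('s, 'a, 'p) egl \<Rightarrow> ('a, 'p) fm \<Rightarrow> bool" where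
  "true_in M \<phi> \<longleftrightarrow> (\<forall>s\<in>states M. val M \<phi> s = 1)"

(* HOL cannot quantify over types inside a definition. Since state spaces are countable, models
   whose states are natural numbers suffice; the lemma valid_true_in below confirms that this
   is truth in all models, whatever the type of their states. *)
definition valid :: "('a, 'p) fm \<Rightarrow> bool" where
  "valid \<phi> \<longleftrightarrow> (\<forall>M :: (nat, 'a, 'p) egl. egl_model M \<longrightarrow> true_in M \<phi>)"

lemma valid_true_in:
  fixes M :: "('s, 'a, 'p) egl"
  assumes "valid \<phi>" and M: "egl_model M"
  shows "true_in M \<phi>"
proof -
  define f where "f = to_nat_on (states M)"
  define g where "g = inv_into (states M) f"
  define N :: "(nat, 'a, 'p) egl" where
    "N = \<lparr>states = f ` states M, rel = (\<lambda>a i j. rel M a (g i) (g j)),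
          interp = (\<lambda>i. interp M (g i))\<rparr>"
  have "inj_on f (states M)"
    using M by (simp add: f_def egl_model_def inj_on_to_nat_on)
  then have gf: "g (f s) = s" if "s \<in> states M" for s
    using that by (simp add: g_def)
  have "egl_model N"
    using M by (auto simp: egl_model_def N_def gf)
  then have N: "true_in N \<phi>"
    using assms(1) by (simp add: valid_def)
  have "val N \<psi> (f s) = val M \<psi> s" if "s \<in> states M" for \<psi> s
    using that
  proof (induction \<psi> arbitrary: s)
    case (B a \<psi>)
    have "(\<lambda>i. max (1 - rel N a (f s) i) (val N \<psi> i)) ` states N =
          (\<lambda>s'. max (1 - rel M a s s') (val M \<psi> s')) ` states M"
      using B by (simp add: N_def gf image_image)
    then show ?case by simp
  qed (simp_all add: N_def gf)
  with N show ?thesis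
    by (auto simp: true_in_def N_def)
qed

definition serial :: "('s, 'a, 'p) egl \<Rightarrow> bool" where
  "serial M \<longleftrightarrow> (\<forall>a. \<forall>s\<in>states M. \<exists>s'\<in>states M. rel M a s s' = 1)"

definition reflexive :: "('s, 'a, 'p) egl \<Rightarrow> bool" where
  "reflexive M \<longleftrightarrow> (\<forall>a. \<forall>s\<in>states M. rel M a s s = 1)"

definition transitive :: "('s, 'a, 'p) egl \<Rightarrow> bool" where
  "transitive M \<longleftrightarrow>
     (\<forall>a. \<forall>s\<in>states M. \<forall>s'\<in>states M. \<forall>s''\<in>states M.
        rel M a s s'' \<ge> min (rel M a s s') (rel M a s' s''))"


datatype gfm = GVar nat | GBot | GAnd gfm gfm | GImp gfm gfm

primrec gval :: "(nat \<Rightarrow> real) \<Rightarrow> gfm \<Rightarrow> real" where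
  "gval v (GVar n) = v n"
| "gval v GBot = 0"
| "gval v (GAnd t u) = min (gval v t) (gval v u)"
| "gval v (GImp t u) = goedel_imp (gval v t) (gval v u)"

definition goedel_tautology :: "gfm \<Rightarrow> bool" where
  "goedel_tautology t \<longleftrightarrow> (\<forall>v. (\<forall>n. v n \<in> {0..1}) \<longrightarrow> gval v t = 1)"

primrec inst :: "(nat \<Rightarrow> ('a, 'p) fm) \<Rightarrow> gfm \<Rightarrow> ('a, 'p) fm" where
  "inst \<sigma> (GVar n) = \<sigma> n"
| "inst \<sigma> GBot = Bot"
| "inst \<sigma> (GAnd t u) = And (inst \<sigma> t) (inst \<sigma> u)"
| "inst \<sigma> (GImp t u) = Imp (inst \<sigma> t) (inst \<sigma> u)"

definition ax_A :: "('a, 'p) fm set" where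
  "ax_A = {inst \<sigma> t | \<sigma> t. goedel_tautology t}"

definition ax_K :: "('a, 'p) fm set" where
  "ax_K = {Imp (B a (Imp \<phi> \<psi>)) (Imp (B a \<phi>) (B a \<psi>)) | a \<phi> \<psi>. True}"

definition ax_D :: "('a, 'p) fm set" where
  "ax_D = {Neg (B a Bot) | a. True}"

definition ax_4 :: "('a, 'p) fm set" where
  "ax_4 = {Imp (B a \<phi>) (B a (B a \<phi>)) | a \<phi>. True}"

definition ax_T :: "('a, 'p) fm set" where
  "ax_T = {Imp (B a \<phi>) \<phi> | a \<phi>. True}"

(* The systems share the rules (R1) and (R2), so each is given by its set of axioms. *)
definition K_F :: "('a, 'p) fm set" where "K_F = ax_A \<union> ax_K"
definition B_F :: "('a, 'p) fm set" where "B_F = K_F \<union> ax_D \<union> ax_4"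
definition T_F :: "('a, 'p) fm set" where "T_F = B_F \<union> ax_T"

(* The side condition of (R2) refers, for every system, to validity in the class of all models. *)
definition derivation :: "('a, 'p) fm set \<Rightarrow> ('a, 'p) fm list \<Rightarrow> bool" where
  "derivation Ax \<phi>s \<longleftrightarrow>
     (\<forall>i<length \<phi>s.
        \<phi>s ! i \<in> Ax \<or>
        (\<exists>j<i. \<exists>k<i. \<phi>s ! k = Imp (\<phi>s ! j) (\<phi>s ! i)) \<or>
        (\<exists>j<i. \<exists>a. valid (\<phi>s ! j) \<and> \<phi>s ! i = B a (\<phi>s ! j)))"

definition derivable :: "('a, 'p) fm set \<Rightarrow> ('a, 'p) fm \<Rightarrow> bool" (infix "\<turnstile>" 50) where
  "Ax \<turnstile> \<phi> \<longleftrightarrow> (\<exists>\<phi>s. \<phi>s \<noteq> [] \<and> last \<phi>s = \<phi> \<and> derivation Ax \<phi>s)"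

definition sound :: "('a, 'p) fm set \<Rightarrow> ('s, 'a, 'p) egl set \<Rightarrow> bool" where
  "sound Ax C \<longleftrightarrow> (\<forall>\<phi>. Ax \<turnstile> \<phi> \<longrightarrow> (\<forall>M\<in>C. true_in M \<phi>))"

end

theory Submission
  imports Defs
begin

text \<open>
  Both rules preserve truth in a fixed model, so only the axioms need checking. For (K) one
  uses that the Goedel implication is the residuum of the minimum, which reduces the axiom to
  distributivity of maximum over minimum under the infimum; (4) follows from transitivity in
  the form
  \<open>1 - r(s,s'') \<le> max (1 - r(s,s')) (1 - r(s',s''))\<close>.
\<close>

lemma goedel_imp_eq_1: "x \<le> y \<Longrightarrow> goedel_imp x y = 1"
  by (simp add: goedel_imp_def)

text \<open>Residuation. The bound on \<open>z\<close> covers the case \<open>x \<le> y\<close>,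
  where the implication has value 1.\<close>

lemma le_goedel_imp_iff: "z \<le> 1 \<Longrightarrow> z \<le> goedel_imp x y \<longleftrightarrow> min z x \<le> y"
  by (auto simp: goedel_imp_def)

text \<open>Infima of reals behave as expected only for nonempty sets bounded below; these bounds
  supply what the modal case needs.\<close>

lemma val_in_unit:
  assumes M: "egl_model M" and "s \<in> states M"
  shows "val M \<phi> s \<in> {0..1}"
  using assms(2)
proof (induction \<phi> arbitrary: s)
  case (Atom p)
  then show ?case using M by (simp add: egl_model_def)
next
  case (B a \<phi>)
  let ?f = "\<lambda>s'. max (1 - rel M a s s') (val M \<phi> s')"
  have f: "?f s' \<in> {0..1}" if "s' \<in> states M" for s'
  proof -
    have "rel M a s s' \<in> {0..1}"
      using M B.prems that by (simp add: egl_model_def)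
    with B.IH[OF that] show ?thesis by (simp add: le_max_iff_disj)
  qed
  have "0 \<le> Inf (?f ` states M)"
    using B.prems f by (intro cINF_greatest) (auto simp del: max.bounded_iff)
  \<comment> \<open>The state \<open>s\<close> itself serves as the member of the index set that
    bounds the infimum from above.\<close>
  moreover have "Inf (?f ` states M) \<le> ?f s"
    using f B.prems by (intro cINF_lower bdd_belowI2[of _ 0]) auto
  ultimately show ?case
    using f[OF B.prems] by (simp only: val.simps atLeastAtMost_iff) (meson order_trans)
qed (auto simp: goedel_imp_def min_def)

text \<open>The characterisation of a greatest lower bound; later arguments handle the infimum
  through it and through \<open>val_B_le\<close>.\<close>

lemma le_val_B_iff:
  assumes M: "egl_model M" and s: "s \<in> states M"
  shows "x \<le> val M (B a \<phi>) s \<longleftrightarrow>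
         (\<forall>s'\<in>states M. x \<le> max (1 - rel M a s s') (val M \<phi> s'))"
proof -
  have "bdd_below ((\<lambda>s'. max (1 - rel M a s s') (val M \<phi> s')) ` states M)"
    \<comment> \<open>The second entry of each maximum is already nonnegative, so 0 is a lower
      bound.\<close>
    using val_in_unit[OF M] by (intro bdd_belowI2[of _ 0]) (simp add: le_max_iff_disj)
  then show ?thesis
    using M by (simp add: le_cINF_iff egl_model_def)
qed

lemma val_B_le:
  assumes "egl_model M" "s \<in> states M" "s' \<in> states M"
  shows "val M (B a \<phi>) s \<le> max (1 - rel M a s s') (val M \<phi> s')"
  using le_val_B_iff[OF assms(1,2), of "val M (B a \<phi>) s" a \<phi>] assms(3) by blast

lemma true_in_ImpI:
  assumes "\<And>s. s \<in> states M \<Longrightarrow> val M \<phi> s \<le> val M \<psi> s"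
  shows "true_in M (Imp \<phi> \<psi>)"
  using assms by (simp add: true_in_def goedel_imp_eq_1)

lemma true_in_mp:
  assumes "egl_model M" "true_in M \<phi>" "true_in M (Imp \<phi> \<psi>)"
  shows "true_in M \<psi>"
  unfolding true_in_def
proof
  fix s assume "s \<in> states M"
  with assms(2,3) val_in_unit[OF assms(1) this, of \<psi>] show "val M \<psi> s = 1"
    by (auto simp: true_in_def goedel_imp_def split: if_splits)
qed

lemma true_in_B:
  assumes M: "egl_model M" and "true_in M \<phi>"
  shows "true_in M (B a \<phi>)"
  unfolding true_in_def
proof
  fix s assume s: "s \<in> states M"
  have "1 \<le> val M (B a \<phi>) s"
    using assms(2) by (subst le_val_B_iff[OF M s]) (simp add: true_in_def)
  with val_in_unit[OF M s, of "B a \<phi>"] show "val M (B a \<phi>) s = 1"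
    by simp
qed

text \<open>At a fixed state, substituting formulas amounts to choosing a propositional valuation;
  by \<open>val_in_unit\<close> its values lie in the unit interval, so tautologies apply.\<close>

lemma val_inst: "val M (inst \<sigma> t) s = gval (\<lambda>n. val M (\<sigma> n) s) t"
  by (induction t) simp_all

lemma true_in_ax_A:
  assumes "egl_model M" "\<phi> \<in> ax_A"
  shows "true_in M \<phi>"
  using assms val_in_unit[OF assms(1)]
  by (auto simp: ax_A_def true_in_def val_inst goedel_tautology_def)

lemma true_in_ax_K:
  assumes M: "egl_model M" and "\<phi> \<in> ax_K"
  shows "true_in M \<phi>"
proof -
  obtain a \<psi> \<chi> where \<phi>: "\<phi> = Imp (B a (Imp \<psi> \<chi>)) (Imp (B a \<psi>) (B a \<chi>))"
    using assms(2) by (auto simp: ax_K_def)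
  show ?thesis
    unfolding \<phi>
  proof (rule true_in_ImpI)
    fix s assume s: "s \<in> states M"
    let ?x = "val M (B a (Imp \<psi> \<chi>)) s" and ?y = "val M (B a \<psi>) s"
    have "min ?x ?y \<le> max (1 - rel M a s s') (val M \<chi> s')" if s': "s' \<in> states M" for s'
    proof -
      have "min (val M (Imp \<psi> \<chi>) s') (val M \<psi> s') \<le> val M \<chi> s'"
        by (simp add: goedel_imp_def min_def)
      \<comment> \<open>Both bounds share the entry \<open>1 - rel M a s s'\<close>: the minimum of
        \<open>max c u\<close> and \<open>max c v\<close> is \<open>max c (min u v)\<close>.\<close>
      with val_B_le[OF M s s', of a "Imp \<psi> \<chi>"] val_B_le[OF M s s', of a \<psi>]
      show ?thesis by linarith
    qed
    then have "min ?x ?y \<le> val M (B a \<chi>) s"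
      by (subst le_val_B_iff[OF M s]) blast
    \<comment> \<open>Residuation at \<open>s\<close>; the modal values stay folded so that they
      match the inequality just proved.\<close>
    then show "?x \<le> val M (Imp (B a \<psi>) (B a \<chi>)) s"
      using val_in_unit[OF M s, of "B a (Imp \<psi> \<chi>)"]
      by (simp add: le_goedel_imp_iff del: val.simps(5))
  qed
qed

lemma true_in_ax_D:
  assumes M: "egl_model M" "serial M" and "\<phi> \<in> ax_D"
  shows "true_in M \<phi>"
proof -
  obtain a where \<phi>: "\<phi> = Neg (B a Bot)"
    using assms(3) by (auto simp: ax_D_def)
  show ?thesis
    unfolding \<phi>
  proof (rule true_in_ImpI)
    fix s assume s: "s \<in> states M"
    then obtain s' where "s' \<in> states M" "rel M a s s' = 1"
      using M(2) by (auto simp: serial_def)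
    \<comment> \<open>Full accessibility makes both entries of the maximum at \<open>s'\<close>
      equal to 0.\<close>
    with val_B_le[OF M(1) s, of s' a Bot] show "val M (B a Bot) s \<le> val M Bot s"
      by simp
  qed
qed

lemma true_in_ax_4:
  assumes M: "egl_model M" "transitive M" and "\<phi> \<in> ax_4"
  shows "true_in M \<phi>"
proof -
  obtain a \<psi> where \<phi>: "\<phi> = Imp (B a \<psi>) (B a (B a \<psi>))"
    using assms(3) by (auto simp: ax_4_def)
  show ?thesis
    unfolding \<phi>
  proof (rule true_in_ImpI)
    fix s assume s: "s \<in> states M"
    let ?x = "val M (B a \<psi>) s"
    have "?x \<le> max (1 - rel M a s s') (val M (B a \<psi>) s')" if s': "s' \<in> states M" for s'
    proof (cases "?x \<le> 1 - rel M a s s'")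
      case False
      have "?x \<le> max (1 - rel M a s' s'') (val M \<psi> s'')" if s'': "s'' \<in> states M" for s''
      proof -
        have "min (rel M a s s') (rel M a s' s'') \<le> rel M a s s''"
          using M(2) s s' s'' by (simp add: transitive_def)
        \<comment> \<open>If \<open>?x\<close> is at most \<open>1 - rel M a s s''\<close>,
          transitivity puts it below one of \<open>1 - rel M a s s'\<close> and
          \<open>1 - rel M a s' s''\<close>; the case assumption rules out the first.\<close>
        with val_B_le[OF M(1) s s'', of a \<psi>] False show ?thesis by linarith
      qed
      then have "?x \<le> val M (B a \<psi>) s'"
        by (subst le_val_B_iff[OF M(1) s']) blast
      then show ?thesis by simp
    qed simp
    then show "?x \<le> val M (B a (B a \<psi>)) s"
      by (subst le_val_B_iff[OF M(1) s]) blast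
  qed
qed

lemma true_in_ax_T:
  assumes M: "egl_model M" "reflexive M" and "\<phi> \<in> ax_T"
  shows "true_in M \<phi>"
proof -
  obtain a \<psi> where \<phi>: "\<phi> = Imp (B a \<psi>) \<psi>"
    using assms(3) by (auto simp: ax_T_def)
  show ?thesis
    unfolding \<phi>
  proof (rule true_in_ImpI)
    fix s assume s: "s \<in> states M"
    then show "val M (B a \<psi>) s \<le> val M \<psi> s"
      \<comment> \<open>Reflexivity turns the bound at \<open>s\<close> into
        \<open>max 0 (val M \<psi> s)\<close>, and values are nonnegative.\<close>
      using val_B_le[OF M(1) s s, of a \<psi>] val_in_unit[OF M(1) s, of \<psi>] M(2)
      by (simp add: reflexive_def)
  qed
qed

text \<open>Strong induction on the position in the derivation, since a rule may draw its premises
  from any earlier positions.\<close>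

lemma derivable_true_in:
  assumes M: "egl_model M" and ax: "\<And>\<psi>. \<psi> \<in> Ax \<Longrightarrow> true_in M \<psi>" and "Ax \<turnstile> \<phi>"
  shows "true_in M \<phi>"
proof -
  obtain \<phi>s where \<phi>s: "\<phi>s \<noteq> []" "last \<phi>s = \<phi>" and der: "derivation Ax \<phi>s"
    using assms(3) by (auto simp: derivable_def)
  have "true_in M (\<phi>s ! i)" if "i < length \<phi>s" for i
    using that
  proof (induction i rule: less_induct)
    case (less i)
    then have IH: "true_in M (\<phi>s ! j)" if "j < i" for j
      using that by simp
    consider "\<phi>s ! i \<in> Ax"
      | j k where "j < i" "k < i" "\<phi>s ! k = Imp (\<phi>s ! j) (\<phi>s ! i)"
      | j a where "j < i" "\<phi>s ! i = B a (\<phi>s ! j)"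
      using der less.prems by (auto simp: derivation_def)
    then show ?case
    proof cases
      case 1
      then show ?thesis by (rule ax)
    next
      case 2
      with IH show ?thesis by (metis true_in_mp[OF M])
    next
      case 3
      with IH show ?thesis by (simp add: true_in_B[OF M])
    qed
  qed
  then show ?thesis
    using \<phi>s by (auto simp: last_conv_nth)
qed

lemma soundI:
  assumes "\<And>M \<phi>. M \<in> C \<Longrightarrow> \<phi> \<in> Ax \<Longrightarrow> true_in M \<phi>" and "\<And>M. M \<in> C \<Longrightarrow> egl_model M"
  shows "sound Ax C"
  unfolding sound_def using assms derivable_true_in by blast

theorem theorem3p1:
  shows "sound K_F {M :: ('s, 'a, 'p) egl. egl_model M} \<and>
         sound B_F {M :: ('s, 'a, 'p) egl. egl_model M \<and> serial M \<and> transitive M} \<and>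
         sound T_F {M :: ('s, 'a, 'p) egl. egl_model M \<and> serial M \<and> transitive M \<and> reflexive M}"
  by (intro conjI soundI)
    (auto simp: K_F_def B_F_def T_F_def
      intro: true_in_ax_A true_in_ax_K true_in_ax_D true_in_ax_4 true_in_ax_T)

end
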